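(* Let $E$ be a Banach space and let $\tau$ be a Hausdorff topology on $E$. Let $\{ T(t) : t \geq 0 \}$ be a one-parameter $\tau$-continuous semigroup of nonexpansive mappings on a compact convex subset $C$ of $E$. Fix $\alpha, \beta > 0$ with $\alpha / \beta \notin \mathbb{Q}$, and $\lambda \in (0,1)$. Define a sequence $\{ x_n \}$ in $C$ by $x_1 \in C$ and $$ x_{n+1} = \frac{\lambda}{n^2} \sum_{k=1}^n \sum_{\ell=1}^n T(k \alpha + \ell \beta) x_n + (1-\lambda) x_n $$ for $n \in \mathbb{N}$. Then $\{ x_n \}$ converges strongly to a common fixed point of $\{ T(t) : t \geq 0 \}$.
   Context: $\mathbb{N}$ is the set of positive integers and $\mathbb{Q}$ the set of rational numbers. Compactness of $C$ and strong convergence refer to the norm topology. Let $C$ be a subset of a Banach space $E$ and let $\tau$ be a Hausdorff topology on $E$ (not necessarily the norm topology). A family $\{T(t) : t \geq 0\}$ of mappings from $C$ into $C$ is called a one-parameter $\tau$-continuous semigroup of nonexpansive mappings on $C$ if: (sg 1) $T(s+t) = T(s) \circ T(t)$ for all $s, t \geq 0$; (sg 2) for each $x \in C$, the mapping $t \mapsto T(t)x$ from $[0,\infty)$ into $C$ is continuous with respect to $\tau$; (sg 3) for each $t \geq 0$, $T(t)$ is nonexpansive, i.e., $\|T(t)x - T(t)y\| \leq \|x-y\|$ for all $x,y \in C$. (It is not required that $T(0)$ be the identity mapping.) A common fixed point of $\{T(t) : t \geq 0\}$ is a point $z \in C$ with $T(t)z = z$ for all $t \geq 0$. *)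

theory Defs
  imports "HOL-Analysis.Analysis"
begin

(* Only the values T t x with t >= 0 and x in C matter; T 0 need not be the identity on C. *)
definition nonexpansive_semigroup_on ::
    "'a::real_normed_vector topology \<Rightarrow> 'a set \<Rightarrow> (real \<Rightarrow> 'a \<Rightarrow> 'a) \<Rightarrow> bool" where
  "nonexpansive_semigroup_on \<tau> C T \<longleftrightarrow>
     (\<forall>t\<ge>0. \<forall>x\<in>C. T t x \<in> C) \<and>
     (\<forall>s\<ge>0. \<forall>t\<ge>0. \<forall>x\<in>C. T (s + t) x = T s (T t x)) \<and>
     (\<forall>x\<in>C. continuous_map (top_of_set {0..}) (subtopology \<tau> C) (\<lambda>t. T t x)) \<and>
     (\<forall>t\<ge>0. \<forall>x\<in>C. \<forall>y\<in>C. norm (T t x - T t y) \<le> norm (x - y))"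

definition common_fixed_point_on :: "'a set \<Rightarrow> (real \<Rightarrow> 'a \<Rightarrow> 'a) \<Rightarrow> 'a \<Rightarrow> bool" where
  "common_fixed_point_on C T z \<longleftrightarrow> z \<in> C \<and> (\<forall>t\<ge>0. T t z = z)"

end

theory Submission
  imports Defs
begin

text \<open>Write \<open>U (k, l) = T (k \<alpha> + l \<beta>)\<close>, a nonexpansive action of the monoid of pairs of naturals,
  and \<open>A n\<close> for the mean of \<open>U\<close> over the \<open>n\<close>-th square. Since consecutive means differ by \<open>O(1/n)\<close>,
  an argument of Goebel--Kirk and Suzuki gives \<open>A n (x n) - x n \<longlonglongrightarrow> 0\<close>, so a cluster point \<open>z\<close> of
  \<open>x\<close> is a limit of means of its own orbit; in a compact set this forces \<open>z\<close> to be fixed by \<open>U\<close>.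
  By irrationality \<open>z\<close> is fixed by \<open>T t\<close> for a dense set of times \<open>t\<close>, hence for all \<open>t\<close>, as
  \<open>{t. T t z = z}\<close> is closed. Finally the distance of \<open>x n\<close> to a common fixed point is decreasing,
  so the whole sequence converges to \<open>z\<close>.\<close>

section \<open>Means over finite sets\<close>

definition mean :: "'b set \<Rightarrow> ('b \<Rightarrow> 'a::real_normed_vector) \<Rightarrow> 'a" where
  "mean F f = sum f F /\<^sub>R real (card F)"

lemma mean_const: "finite F \<Longrightarrow> F \<noteq> {} \<Longrightarrow> mean F (\<lambda>_. c) = c"
  by (simp add: mean_def sum_constant_scaleR)

lemma mean_diff: "mean F (\<lambda>i. f i - g i) = mean F f - mean F g"
  by (simp add: mean_def sum_subtractf scaleR_diff_right)

lemma norm_mean_le: "norm (mean F f) \<le> mean F (\<lambda>i. norm (f i))"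
  by (simp add: mean_def norm_sum mult_left_mono)

lemma mean_mono:
  fixes f g :: "'b \<Rightarrow> real"
  shows "(\<And>i. i \<in> F \<Longrightarrow> f i \<le> g i) \<Longrightarrow> mean F f \<le> mean F g"
  by (simp add: mean_def sum_mono mult_left_mono)

lemma norm_mean_diff_le:
  assumes "finite F" "F \<noteq> {}" "\<And>i. i \<in> F \<Longrightarrow> norm (f i - g i) \<le> c"
  shows "norm (mean F f - mean F g) \<le> c"
proof -
  have "norm (mean F f - mean F g) \<le> mean F (\<lambda>i. norm (f i - g i))"
    using norm_mean_le[of F "\<lambda>i. f i - g i"] by (simp add: mean_diff)
  also have "\<dots> \<le> mean F (\<lambda>_. c)"
    by (rule mean_mono) (use assms in auto)
  also have "\<dots> = c"
    using assms by (simp add: mean_const)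
  finally show ?thesis .
qed

lemma mean_in_convex:
  assumes "convex C" "finite F" "F \<noteq> {}" "\<And>i. i \<in> F \<Longrightarrow> f i \<in> C"
  shows "mean F f \<in> C"
proof -
  have "(\<Sum>i\<in>F. (1 / real (card F)) *\<^sub>R f i) \<in> C"
    by (rule convex_sum) (use assms in auto)
  then show ?thesis
    by (simp add: mean_def scaleR_sum_right divide_inverse)
qed

text \<open>Two equal errors give the factor 2: the terms outside \<open>A\<close> have total weight
  \<open>(b - a) / b\<close>, and reweighting \<open>A\<close> from \<open>1 / a\<close> to
  \<open>1 / b\<close> changes its part by at most \<open>a * M * (1 / a - 1 / b)\<close>, where
  \<open>a\<close> and \<open>b\<close> are the cardinalities.\<close>

lemma norm_mean_superset_diff_le:
  assumes "finite B" "A \<subseteq> B" "A \<noteq> {}" and M: "\<And>i. i \<in> B \<Longrightarrow> norm (f i) \<le> M"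
  shows "norm (mean B f - mean A f) \<le> 2 * M * (real (card B) - real (card A)) / real (card B)"
proof -
  define a b where "a = real (card A)" and "b = real (card B)"
  have finA: "finite A" using assms finite_subset by blast
  have a: "0 < a" and ab: "a \<le> b"
    using assms finA by (auto simp: a_def b_def card_gt_0_iff card_mono)
  have cBA: "real (card (B - A)) = b - a"
    using assms finA ab by (simp add: card_Diff_subset a_def b_def of_nat_diff)
  have s: "sum f B = sum f (B - A) + sum f A"
    using assms by (simp add: sum.subset_diff)
  have "mean B f - mean A f = sum f (B - A) /\<^sub>R b - (1 / a - 1 / b) *\<^sub>R sum f A"
    by (simp add: mean_def s a_def b_def scaleR_add_right scaleR_diff_left divide_inverse)
  then have "norm (mean B f - mean A f) \<le> norm (sum f (B - A) /\<^sub>R b) + norm ((1 / a - 1 / b) *\<^sub>R sum f A)"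
    by (metis norm_triangle_ineq4)
  also have "\<dots> = norm (sum f (B - A)) / b + (1 / a - 1 / b) * norm (sum f A)"
    using a ab by (simp add: divide_inverse mult.commute abs_of_nonneg le_imp_inverse_le)
  also have "\<dots> \<le> ((b - a) * M) / b + (1 / a - 1 / b) * (a * M)"
  proof (intro add_mono divide_right_mono mult_left_mono)
    show "norm (sum f (B - A)) \<le> (b - a) * M"
      using sum_norm_bound[of "B - A" f M] M cBA by auto
    show "norm (sum f A) \<le> a * M"
      using sum_norm_bound[of A f M] M assms(2) by (auto simp: a_def)
    show "0 \<le> 1 / a - 1 / b" "0 \<le> b"
      using a ab by (auto simp: frac_le)
  qed
  also have "\<dots> = 2 * M * (b - a) / b"
    using a ab by (simp add: field_simps)
  finally show ?thesis
    by (simp add: a_def b_def)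
qed

section \<open>Nonexpansive actions of commutative monoids\<close>

text \<open>No law for \<open>U 0\<close> is imposed, since \<open>T 0\<close> may differ from the
  identity. The monoid carries no order; being later than \<open>p + b\<close> is expressed by the
  form \<open>p + b + d\<close>.\<close>

locale nonexpansive_action =
  fixes C :: "'a::real_normed_vector set" and U :: "'g::comm_monoid_add \<Rightarrow> 'a \<Rightarrow> 'a"
  assumes closed: "x \<in> C \<Longrightarrow> U g x \<in> C"
    and add: "x \<in> C \<Longrightarrow> U (g + h) x = U g (U h x)"
    and nonexpansive: "x \<in> C \<Longrightarrow> y \<in> C \<Longrightarrow> norm (U g x - U g y) \<le> norm (x - y)"
begin

lemma norm_translate_le:
  assumes "z \<in> C"
  shows "norm (U (g + h) z - U (g + k) z) \<le> norm (U h z - U k z)"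
  using assms by (simp add: add closed nonexpansive)

text \<open>Otherwise each \<open>p\<close> has a \<open>b p\<close> such that the orbit stays
  \<epsilon>-away from \<open>U p z\<close> at all times beyond \<open>p + b p\<close>. Jumping
  repeatedly from \<open>p\<close> to \<open>p + b p\<close> then yields an \<epsilon>-separated
  sequence in a compact set.\<close>

lemma orbit_recurrent:
  assumes "compact C" "z \<in> C" "\<epsilon> > 0"
  obtains p where "\<And>b. \<exists>d. norm (U (p + b + d) z - U p z) < \<epsilon>"
proof (rule ccontr)
  assume "\<not> thesis"
  then have "\<forall>p. \<exists>b. \<forall>d. \<epsilon> \<le> norm (U (p + b + d) z - U p z)"
    using that by (meson not_le)
  then obtain b where b: "\<And>p d. \<epsilon> \<le> norm (U (p + b p + d) z - U p z)"
    by metis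
  define P where "P = rec_nat 0 (\<lambda>_ p. p + b p)"
  have P_Suc: "P (Suc n) = P n + b (P n)" for n
    by (simp add: P_def)
  have P_less: "\<exists>d. P (n + Suc k) = P n + b (P n) + d" for n k
  proof (induction k)
    case 0
    show ?case by (rule exI[of _ 0]) (simp add: P_Suc)
  next
    case (Suc k)
    then obtain d where "P (n + Suc k) = P n + b (P n) + d"
      by blast
    then have "P (n + Suc (Suc k)) = P n + b (P n) + (d + b (P (n + Suc k)))"
      using P_Suc[of "n + Suc k"] by (simp add: add.assoc)
    then show ?case by blast
  qed
  have sep: "\<epsilon> \<le> norm (U (P m) z - U (P n) z)" if "n < m" for m n
  proof -
    obtain k where "m = n + Suc k"
      using \<open>n < m\<close> less_iff_Suc_add by auto
    then show ?thesis
      using P_less[of n k] b by metis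
  qed
  have "\<forall>n. U (P n) z \<in> C"
    using assms closed by blast
  then obtain l \<sigma> where \<sigma>: "strict_mono (\<sigma> :: nat \<Rightarrow> nat)" "((\<lambda>n. U (P n) z) \<circ> \<sigma>) \<longlonglongrightarrow> l"
    using compact_imp_seq_compact[OF \<open>compact C\<close>] by (metis seq_compactE)
  then have "Cauchy ((\<lambda>n. U (P n) z) \<circ> \<sigma>)"
    using LIMSEQ_imp_Cauchy by blast
  then obtain M where "\<forall>m\<ge>M. \<forall>n\<ge>M. norm (U (P (\<sigma> m)) z - U (P (\<sigma> n)) z) < \<epsilon>"
    using \<open>\<epsilon> > 0\<close> unfolding Cauchy_iff comp_def by blast
  then have "norm (U (P (\<sigma> (Suc M))) z - U (P (\<sigma> M)) z) < \<epsilon>"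
    by simp
  moreover have "\<sigma> M < \<sigma> (Suc M)"
    using \<sigma>(1) by (simp add: strict_mono_def)
  ultimately show False
    using sep by fastforce
qed

text \<open>The number \<open>r\<close> is the smallest limit of mean distances from a point of the orbit to the orbit.
  Since \<open>z\<close> is itself a limit of means, its distances to far points of the orbit are at most \<open>r\<close>,
  and recurrence spreads this bound to all far pairs. A positive proportion of the orbit lies in
  a single ball of radius \<open>r/4\<close>, which pushes a mean distance below \<open>r\<close> unless \<open>r = 0\<close>.\<close>

theorem fixed_point_if_mean_tendsto:
  fixes F :: "nat \<Rightarrow> 'g set"
  assumes C: "compact C" and z: "z \<in> C"
    and fin: "\<And>n. finite (F n)" and ne: "\<And>n. F n \<noteq> {}"
    and folner: "\<And>g. (\<lambda>n. real (card (F n - (+) g ` F n)) / real (card (F n))) \<longlonglongrightarrow> 0"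
    and lim: "(\<lambda>n. mean (F n) (\<lambda>g. U g z)) \<longlonglongrightarrow> z"
  shows "U g z = z"
proof -
  note [simp] = fin
  have cF: "real (card (F n)) > 0" for n
    using ne by (simp add: card_gt_0_iff)
  define D where "D = diameter C"
  have D: "norm (x - y) \<le> D" if "x \<in> C" "y \<in> C" for x y
    using diameter_bounded_bound[OF compact_imp_bounded[OF C]] that by (simp add: D_def dist_norm)
  have D0: "0 \<le> D"
    using D[OF z z] by simp
  have UC [simp]: "U g z \<in> C" for g
    using closed z by blast
  \<comment> \<open>The share of \<open>F n\<close> missed by its translate, each missed index being
    charged the diameter bound \<open>D\<close>.\<close>
  define Q where "Q a n = D * (real (card (F n - (+) a ` F n)) / real (card (F n)))" for a n
  have Q0: "Q a \<longlonglongrightarrow> 0" for a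
    unfolding Q_def using tendsto_mult_right_zero[OF folner] by simp
  have Q_small: "\<forall>\<^sub>F n in sequentially. Q a n < \<epsilon>" if "\<epsilon> > 0" for a \<epsilon>
    using order_tendstoD(2)[OF Q0 that] .
  define B where "B n y = mean (F n) (\<lambda>m. norm (U m z - y))" for n y
  have B_eq: "B n y * real (card (F n)) = (\<Sum>m\<in>F n. norm (U m z - y))" for n y
    using cF[of n] by (simp add: B_def mean_def divide_inverse[symmetric] mult.commute)
  \<comment> \<open>At indices \<open>a + d\<close> with \<open>d\<close> in \<open>F n\<close>,
    nonexpansiveness of \<open>U a\<close> leads back to the distance between \<open>U d z\<close>
    and \<open>y\<close>; the other indices cost at most \<open>D\<close> each.\<close>
  have B_shift: "B n (U a y) \<le> B n y + Q a n" if y: "y \<in> C" for n a y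
  proof -
    let ?I = "(+) a ` F n"
    have "(\<Sum>m\<in>F n. norm (U m z - U a y))
        = (\<Sum>m\<in>F n \<inter> ?I. norm (U m z - U a y)) + (\<Sum>m\<in>F n - ?I. norm (U m z - U a y))"
      by (subst sum.Int_Diff[of _ _ ?I]) auto
    also have "\<dots> \<le> (\<Sum>m\<in>?I. norm (U m z - U a y)) + (\<Sum>m\<in>F n - ?I. D)"
      by (intro add_mono sum_mono sum_mono2 D) (use y closed in auto)
    \<comment> \<open>Translation may identify indices, as no cancellation law is assumed; for
      non-negative terms this only lowers the sum over the image.\<close>
    also have "(\<Sum>m\<in>?I. norm (U m z - U a y)) \<le> (\<Sum>d\<in>F n. norm (U (a + d) z - U a y))"
      using sum_image_le[of "F n" "\<lambda>m. norm (U m z - U a y)" "(+) a"] by (simp add: comp_def)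
    also have "\<dots> \<le> (\<Sum>d\<in>F n. norm (U d z - y))"
      by (intro sum_mono) (use y z in \<open>simp add: add closed nonexpansive\<close>)
    finally have "B n (U a y) * real (card (F n)) \<le> (B n y + Q a n) * real (card (F n))"
      using cF[of n] by (simp only: B_eq distrib_right) (simp add: Q_def mult.commute)
    then show ?thesis
      using cF[of n] by simp
  qed
  \<comment> \<open>Frequent bounds encode lower limits: \<open>r\<close> is the infimum over
    \<open>g\<close> of the lower limits of \<open>B n (U g z)\<close>.\<close>
  define R where "R = {c. \<exists>g. \<exists>\<^sub>F n in sequentially. B n (U g z) \<le> c}"
  define r where "r = Inf R"
  have B_nonneg: "0 \<le> B n y" for n y
    by (simp add: B_def mean_def sum_nonneg)
  have R_nonneg: "0 \<le> c" if c: "c \<in> R" for c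
  proof -
    obtain g n where "B n (U g z) \<le> c"
      using c unfolding R_def by (auto dest!: frequently_ex)
    then show ?thesis
      using B_nonneg order_trans by blast
  qed
  then have bdd: "bdd_below R"
    by (rule bdd_belowI)
  have "B n (U 0 z) \<le> D" for n
    unfolding B_def using mean_mono[of "F n" "\<lambda>m. norm (U m z - U 0 z)" "\<lambda>_. D"] D ne
    by (simp add: mean_const)
  then have "D \<in> R"
    unfolding R_def by (auto intro!: exI[of _ 0] eventually_frequently)
  then have "r \<ge> 0"
    unfolding r_def using R_nonneg by (auto intro: cInf_greatest)

  \<comment> \<open>Distances between far points of the orbit\<close>
  have near: "\<exists>g0. \<forall>g. norm (z - U (g + g0) z) \<le> c" if "r < c" for c
  proof -
    obtain c' where c': "c' < c" "c' \<in> R"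
      using \<open>r < c\<close> \<open>D \<in> R\<close> bdd unfolding r_def by (metis cInf_less_iff empty_iff)
    then obtain g0 where g0: "\<exists>\<^sub>F n in sequentially. B n (U g0 z) \<le> c'"
      unfolding R_def by auto
    \<comment> \<open>Half of the gap pays for replacing \<open>z\<close> by a mean of its orbit,
      half for the shift by \<open>g\<close>. Both errors are eventually small and the bound at
      \<open>g0\<close> holds frequently, so one \<open>n\<close> serves all three.\<close>
    define \<epsilon> where "\<epsilon> = (c - c') / 2"
    have "\<epsilon> > 0" using c' by (simp add: \<epsilon>_def)
    have "norm (z - U (g + g0) z) \<le> c" for g
    proof -
      have "\<forall>\<^sub>F n in sequentially. dist (mean (F n) (\<lambda>g. U g z)) z < \<epsilon>"
        using lim \<open>\<epsilon> > 0\<close> by (auto dest: tendstoD)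
      then have "\<exists>\<^sub>F n in sequentially. B n (U g0 z) \<le> c' \<and> Q g n < \<epsilon> \<and> dist (mean (F n) (\<lambda>g. U g z)) z < \<epsilon>"
        using g0 Q_small[OF \<open>\<epsilon> > 0\<close>]
        by (intro frequently_eventually_frequently eventually_conj)
      then obtain n where n: "B n (U g0 z) \<le> c'" "Q g n < \<epsilon>" "dist (mean (F n) (\<lambda>g. U g z)) z < \<epsilon>"
        by (auto dest: frequently_ex)
      have "norm (z - U (g + g0) z)
          \<le> norm (z - mean (F n) (\<lambda>g. U g z)) + norm (mean (F n) (\<lambda>g. U g z) - U (g + g0) z)"
        using norm_triangle_ineq[of "z - mean (F n) (\<lambda>g. U g z)" "mean (F n) (\<lambda>g. U g z) - U (g + g0) z"]
        by simp
      also have "norm (mean (F n) (\<lambda>g. U g z) - U (g + g0) z) \<le> B n (U (g + g0) z)"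
        using norm_mean_le[of "F n" "\<lambda>m. U m z - U (g + g0) z"] ne[of n]
        by (simp add: mean_diff mean_const B_def)
      also have "\<dots> \<le> B n (U g0 z) + Q g n"
        using B_shift[of "U g0 z" n g] z by (simp add: add)
      finally show ?thesis
        using n by (simp add: dist_norm norm_minus_commute \<epsilon>_def)
    qed
    then show ?thesis by blast
  qed
  have diam: "\<exists>p. \<forall>i e. norm (U i z - U (p + e) z) \<le> c" if "r < c" for c
  proof -
    define c' where "c' = (r + c) / 2"
    have c': "r < c'" "c' < c" using that by (auto simp: c'_def)
    obtain g0 where g0: "\<And>g. norm (z - U (g + g0) z) \<le> c'"
      using near[OF c'(1)] by blast
    obtain p where p: "\<And>b. \<exists>d. norm (U (p + b + d) z - U p z) < c - c'"
      using orbit_recurrent[OF C z, of "c - c'"] c' by auto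
    have "norm (U i z - U (p + e) z) \<le> c" for i e
    proof -
      obtain d where d: "norm (U (p + (i + g0) + d) z - U p z) < c - c'"
        using p by blast
      \<comment> \<open>The index is read in two ways: \<open>i\<close> plus a time beyond
        \<open>g0\<close> puts \<open>?w\<close> within \<open>c'\<close> of \<open>U i z\<close>;
        \<open>e\<close> plus the return time \<open>p + (i + g0) + d\<close> puts it close to
        \<open>U (p + e) z\<close>.\<close>
      let ?w = "U (i + ((p + e + d) + g0)) z"
      have "norm (U i z - ?w) \<le> norm (z - U ((p + e + d) + g0) z)"
        using z by (simp only: add[of z i] nonexpansive UC)
      then have 1: "norm (U i z - ?w) \<le> c'"
        using g0 order_trans by blast
      have "norm (U (e + (p + (i + g0) + d)) z - U (e + p) z) < c - c'"
        using norm_translate_le[OF z] d le_less_trans by blast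
      then have "norm (?w - U (p + e) z) < c - c'"
        by (simp add: ac_simps)
      then show ?thesis
        using 1 norm_triangle_ineq[of "U i z - ?w" "?w - U (p + e) z"] by simp
    qed
    then show ?thesis by blast
  qed

  \<comment> \<open>Vanishing of the smallest mean distance\<close>
  have "r = 0"
  proof (rule ccontr)
    assume "r \<noteq> 0"
    with \<open>r \<ge> 0\<close> have "r > 0" by simp
    then obtain K where K: "finite K" "K \<subseteq> C" "C \<subseteq> (\<Union>x\<in>K. ball x (r / 4))"
      using seq_compact_imp_totally_bounded[OF compact_imp_seq_compact[OF C]]
      by (meson divide_pos_pos zero_less_numeral)
    define N where "N = real (card K)"
    have "K \<noteq> {}" using K z by auto
    then have "N > 0" using K by (simp add: N_def card_gt_0_iff)
    define V where "V f n = {m \<in> F n. U m z \<in> ball f (r / 4)}" for f n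
    \<comment> \<open>Pigeonhole: the balls cover the orbit, so one of them captures at least the
      fraction \<open>1 / N\<close> of the indices. As \<open>K\<close> is finite, a single centre
      then serves for infinitely many \<open>n\<close>.\<close>
    have "\<exists>f\<in>K. real (card (F n)) \<le> N * real (card (V f n))" for n
    proof (rule ccontr)
      assume "\<not> ?thesis"
      then have less: "N * real (card (V f n)) < real (card (F n))" if "f \<in> K" for f
        using that by force
      have "F n = (\<Union>f\<in>K. V f n)"
        using K UC unfolding V_def by blast
      then have "card (F n) \<le> (\<Sum>f\<in>K. card (V f n))"
        using card_UN_le[OF K(1), of "\<lambda>f. V f n"] by simp
      then have "N * real (card (F n)) \<le> N * (\<Sum>f\<in>K. real (card (V f n)))"
        using \<open>N > 0\<close> by (simp flip: of_nat_sum)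
      also have "\<dots> = (\<Sum>f\<in>K. N * real (card (V f n)))"
        by (simp add: sum_distrib_left)
      also have "\<dots> < (\<Sum>f\<in>K. real (card (F n)))"
        by (intro sum_strict_mono less K \<open>K \<noteq> {}\<close>)
      finally show False
        by (simp add: N_def)
    qed
    then have "\<exists>f\<in>K. \<exists>\<^sub>F n in sequentially. real (card (F n)) \<le> N * real (card (V f n))"
      by (intro frequently_bex_finite K eventually_frequently) auto
    then obtain f where freq: "\<exists>\<^sub>F n in sequentially. real (card (F n)) \<le> N * real (card (V f n))"
      by blast
    then obtain n0 where "real (card (F n0)) \<le> N * real (card (V f n0))"
      by (auto dest: frequently_ex)
    then have "V f n0 \<noteq> {}"
      using cF[of n0] by auto
    then obtain i where i: "U i z \<in> ball f (r / 4)"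
      unfolding V_def by blast
    \<comment> \<open>The ball lowers the mean distance by at least \<open>r / (2 * N)\<close>,
      while the excess over \<open>r\<close> in \<open>diam\<close> and the indices missed by the
      translate cost at most \<epsilon> each; the net gain is \<open>r / (4 * N)\<close>.\<close>
    define \<epsilon> where "\<epsilon> = r / (8 * N)"
    have "\<epsilon> > 0" using \<open>r > 0\<close> \<open>N > 0\<close> by (simp add: \<epsilon>_def)
    obtain p where p: "\<And>i e. norm (U i z - U (p + e) z) \<le> r + \<epsilon>"
      using diam[of "r + \<epsilon>"] \<open>\<epsilon> > 0\<close> by auto
    have B_le: "B n (U i z) \<le> r - r / (4 * N)"
      if n: "real (card (F n)) \<le> N * real (card (V f n))" "Q p n < \<epsilon>" for n
    proof -
      let ?bad = "F n - (+) p ` F n"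
      have pt: "norm (U m z - U i z)
          \<le> (r + \<epsilon>) - r / 2 * of_bool (m \<in> V f n) + D * of_bool (m \<in> ?bad)"
        if m: "m \<in> F n" for m
      proof (cases "m \<in> V f n")
        case True
        then have "dist (U m z) (U i z) < r / 2"
          using i dist_triangle_half_r[of f "U m z" "r / 2" "U i z"] unfolding V_def by simp
        then show ?thesis
          using True D0 \<open>\<epsilon> > 0\<close> by (auto simp: dist_norm)
      next
        case False
        show ?thesis
        proof (cases "m \<in> ?bad")
          case True
          then show ?thesis
            using False D[of "U m z" "U i z"] \<open>r > 0\<close> \<open>\<epsilon> > 0\<close> by simp
        next
          case no: False
          then obtain d where "m = p + d"
            using m by blast
          then show ?thesis
            using p[of i d] False no m by (auto simp: norm_minus_commute)
        qed
      qed
      have sV: "(\<Sum>m\<in>F n. of_bool (m \<in> V f n)) = real (card (V f n))"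
        by (simp add: V_def Int_def)
      have sb: "(\<Sum>m\<in>F n. of_bool (m \<in> ?bad)) = real (card ?bad)"
        by (simp add: set_diff_eq Int_def)
      have "(\<Sum>m\<in>F n. norm (U m z - U i z))
          \<le> (\<Sum>m\<in>F n. (r + \<epsilon>) - r / 2 * of_bool (m \<in> V f n) + D * of_bool (m \<in> ?bad))"
        by (intro sum_mono pt)
      also have "\<dots> = (r + \<epsilon>) * real (card (F n)) - r / 2 * real (card (V f n)) + D * real (card ?bad)"
        by (simp only: sum.distrib sum_subtractf flip: sum_distrib_left sV sb) (simp add: algebra_simps)
      also have "D * real (card ?bad) = Q p n * real (card (F n))"
        using cF[of n] by (simp add: Q_def)
      also have "\<dots> \<le> \<epsilon> * real (card (F n))"
        using n(2) cF[of n] by (intro mult_right_mono) auto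
      finally have "B n (U i z) * real (card (F n))
          \<le> (r + 2 * \<epsilon>) * real (card (F n)) - r / 2 * real (card (V f n))"
        unfolding B_eq by (simp add: algebra_simps)
      moreover have "r / (2 * N) * real (card (F n)) \<le> r / 2 * real (card (V f n))"
        using n(1) \<open>r > 0\<close> \<open>N > 0\<close> by (simp add: field_simps)
      ultimately have "B n (U i z) * real (card (F n)) \<le> (r + 2 * \<epsilon> - r / (2 * N)) * real (card (F n))"
        by (simp add: left_diff_distrib)
      then have "B n (U i z) \<le> r + 2 * \<epsilon> - r / (2 * N)"
        using cF[of n] by simp
      then show ?thesis
        by (simp add: \<epsilon>_def field_simps)
    qed
    have "\<exists>\<^sub>F n in sequentially. B n (U i z) \<le> r - r / (4 * N)"
      using frequently_eventually_frequently[OF freq Q_small[OF \<open>\<epsilon> > 0\<close>, of p]]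
      by (rule frequently_elim1) (use B_le in blast)
    then have "r - r / (4 * N) \<in> R"
      unfolding R_def by blast
    then have "r \<le> r - r / (4 * N)"
      using bdd unfolding r_def by (rule cInf_lower)
    then show False
      using \<open>r > 0\<close> \<open>N > 0\<close> by (simp add: field_simps)
  qed
  \<comment> \<open>With \<open>r = 0\<close> the whole orbit lies in arbitrarily small balls, so it
    is constant. The summand 0 fits the shape of \<open>field_le_epsilon\<close>.\<close>
  have "norm (U i z - U j z) \<le> 0 + \<epsilon>" if \<epsilon>: "\<epsilon> > 0" for i j \<epsilon>
  proof -
    obtain p where p: "\<And>i e. norm (U i z - U (p + e) z) \<le> \<epsilon> / 2"
      using diam[of "\<epsilon> / 2"] \<epsilon> \<open>r = 0\<close> by auto
    show ?thesis
      using norm_triangle_ineq4[of "U i z - U (p + 0) z" "U j z - U (p + 0) z"] p[of i 0] p[of j 0]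
      by simp
  qed
  then have const: "U i z = U j z" for i j
    using field_le_epsilon[of "norm (U i z - U j z)" 0] by auto
  have "(\<lambda>m. U m z) = (\<lambda>_. U g z)"
    using const by blast
  then have "(\<lambda>n. mean (F n) (\<lambda>m. U m z)) = (\<lambda>n. U g z)"
    using ne by (simp add: mean_const)
  then show ?thesis
    using lim LIMSEQ_unique by (metis tendsto_const)
qed

end

section \<open>Averaged iterations\<close>

text \<open>The upper limit \<open>d\<close> is the infimum of the eventual upper bounds, and
  \<open>\<sigma> i\<close> is any index from \<open>i\<close> on at which \<open>e\<close> exceeds
  \<open>d - 1 / Suc i\<close>.\<close>

lemma limsup_subseq_real:
  fixes e :: "nat \<Rightarrow> real"
  assumes "\<And>n. 0 \<le> e n" "\<And>n. e n \<le> M"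
  obtains d \<sigma> where "filterlim \<sigma> at_top sequentially" "(e \<circ> \<sigma>) \<longlonglongrightarrow> d"
    "\<And>c. d < c \<Longrightarrow> \<forall>\<^sub>F n in sequentially. e n < c"
proof -
  define R where "R = {c. \<forall>\<^sub>F n in sequentially. e n \<le> c}"
  define d where "d = Inf R"
  have R0: "0 \<le> c" if "c \<in> R" for c
  proof -
    from that have "\<forall>\<^sub>F n in sequentially. e n \<le> c"
      by (simp add: R_def)
    then obtain n where "e n \<le> c"
      using eventually_happens' sequentially_bot by blast
    then show ?thesis
      using assms(1) order_trans by blast
  qed
  then have bdd: "bdd_below R"
    by (rule bdd_belowI)
  have "M \<in> R"
    using assms by (simp add: R_def)
  have upper: "\<forall>\<^sub>F n in sequentially. e n < c" if c: "d < c" for c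
  proof -
    obtain c' where "c' \<in> R" "c' < c"
      using cInf_less_iff[OF _ bdd] c \<open>M \<in> R\<close> unfolding d_def by blast
    then show ?thesis
      unfolding R_def by (auto elim: eventually_mono)
  qed
  have "\<exists>n\<ge>i. d - 1 / Suc i < e n" for i
  proof (rule ccontr)
    assume "\<not> ?thesis"
    then have "d - 1 / Suc i \<in> R"
      unfolding R_def eventually_sequentially by (force simp: not_less)
    then have "d \<le> d - 1 / Suc i"
      unfolding d_def using bdd by (intro cInf_lower)
    then show False
      by simp
  qed
  then obtain \<sigma> where \<sigma>: "\<And>i. i \<le> \<sigma> i" "\<And>i. d - 1 / Suc i < e (\<sigma> i)"
    by metis
  have top: "filterlim \<sigma> at_top sequentially"
    using filterlim_at_top_mono[OF filterlim_ident, of \<sigma>] \<sigma>(1) by simp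
  have lim: "(e \<circ> \<sigma>) \<longlonglongrightarrow> d"
  proof (rule order_tendstoI)
    fix a assume "a < d"
    have "(\<lambda>i. d - 1 / Suc i) \<longlonglongrightarrow> d - 0"
      by (intro tendsto_diff tendsto_const LIMSEQ_Suc[OF lim_1_over_n])
    then have "\<forall>\<^sub>F i in sequentially. a < d - 1 / Suc i"
      using \<open>a < d\<close> by (simp add: order_tendstoD)
    then show "\<forall>\<^sub>F i in sequentially. a < (e \<circ> \<sigma>) i"
      by eventually_elim (use \<sigma>(2) in \<open>auto intro: less_trans\<close>)
  next
    fix a assume "d < a"
    then show "\<forall>\<^sub>F i in sequentially. (e \<circ> \<sigma>) i < a"
      using eventually_compose_filterlim[OF upper top] by simp
  qed
  show thesis
    by (rule that[OF top lim upper])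
qed

text \<open>Let \<open>d\<close> be the upper limit of the distances from \<open>y n\<close> to
  \<open>x n\<close>. These are almost non-increasing, so they stay near \<open>d\<close> during
  long stretches before suitable times. If \<open>d > 0\<close>, the steps of \<open>x\<close>, of
  length about \<open>lam * d\<close>, add up there without cancellation, contradicting
  boundedness.\<close>

theorem averaged_iteration_asymptotic:
  fixes x y :: "nat \<Rightarrow> 'a::real_normed_vector"
  assumes x: "\<And>n. norm (x n) \<le> M" and y: "\<And>n. norm (y n) \<le> M"
    and lam: "0 < lam" "lam < 1"
    and step: "\<And>n. x (Suc n) = lam *\<^sub>R y n + (1 - lam) *\<^sub>R x n"
    and \<delta>: "\<delta> \<longlonglongrightarrow> 0"
    and dy: "\<And>n. norm (y (Suc n) - y n) \<le> norm (x (Suc n) - x n) + \<delta> n"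
  shows "(\<lambda>n. y n - x n) \<longlonglongrightarrow> 0"
proof -
  define e where "e n = norm (y n - x n)" for n
  have e_bounds: "0 \<le> e n" "e n \<le> 2 * M" for n
    using norm_triangle_ineq4[of "y n" "x n"] x[of n] y[of n] by (simp_all add: e_def)
  obtain d \<sigma> where \<sigma>: "filterlim \<sigma> at_top sequentially" and lim: "(e \<circ> \<sigma>) \<longlonglongrightarrow> d"
    and upper: "\<And>c. d < c \<Longrightarrow> \<forall>\<^sub>F n in sequentially. e n < c"
    by (rule limsup_subseq_real[of e "2 * M", OF e_bounds]) (rule that)
  have dx: "norm (x (Suc n) - x n) = lam * e n" for n
  proof -
    have "x (Suc n) - x n = lam *\<^sub>R (y n - x n)"
      by (simp add: step algebra_simps)
    then show ?thesis
      using lam by (simp add: e_def)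
  qed
  have dy': "norm (y (Suc n) - y n) \<le> lam * e n + \<delta> n" for n
    using dy[of n] dx[of n] by simp
  have e_Suc: "e (Suc n) \<le> e n + \<delta> n" for n
  proof -
    have eq: "y (Suc n) - x (Suc n) = (y (Suc n) - y n) + (1 - lam) *\<^sub>R (y n - x n)"
      by (simp add: step algebra_simps)
    have "e (Suc n) \<le> norm (y (Suc n) - y n) + (1 - lam) * e n"
      using norm_triangle_ineq[of "y (Suc n) - y n" "(1 - lam) *\<^sub>R (y n - x n)"] lam
      unfolding e_def eq by simp
    then show ?thesis
      using dy'[of n] by (simp add: algebra_simps)
  qed
  have e_upto: "e (n + j) \<le> e n + (\<Sum>i<j. \<delta> (n + i))" for n j
  proof (induction j)
    case (Suc j)
    then show ?case
      using e_Suc[of "n + j"] by simp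
  qed simp
  have back_top: "filterlim (\<lambda>i. \<sigma> i - j) at_top sequentially" for j
    using filterlim_compose[OF filterlim_minus_const_nat_at_top \<sigma>] by simp
  have "d \<ge> 0"
    using lim by (rule LIMSEQ_le_const) (simp add: e_def)
  have \<delta>_back: "(\<lambda>i. \<delta> (\<sigma> i - j + k)) \<longlonglongrightarrow> 0" for j k
    using filterlim_compose[OF LIMSEQ_ignore_initial_segment[OF \<delta>, of k] back_top[of j]] by simp
  have le_\<sigma>: "\<forall>\<^sub>F i in sequentially. j \<le> \<sigma> i" for j
    using \<sigma> by (simp add: filterlim_at_top)
  \<comment> \<open>Over \<open>j\<close> steps \<open>e\<close> rises by at most a vanishing sum,
    so it cannot be much smaller at \<open>\<sigma> i - j\<close> than at
    \<open>\<sigma> i\<close>.\<close>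
  have e_back: "(\<lambda>i. e (\<sigma> i - j)) \<longlonglongrightarrow> d" for j
  proof (rule order_tendstoI)
    fix a assume "a < d"
    have "(\<lambda>i. (e \<circ> \<sigma>) i - (\<Sum>k<j. \<delta> (\<sigma> i - j + k))) \<longlonglongrightarrow> d - (\<Sum>k<j. 0)"
      by (intro tendsto_diff tendsto_sum lim \<delta>_back)
    then have "\<forall>\<^sub>F i in sequentially. a < (e \<circ> \<sigma>) i - (\<Sum>k<j. \<delta> (\<sigma> i - j + k))"
      using \<open>a < d\<close> by (simp add: order_tendstoD)
    then show "\<forall>\<^sub>F i in sequentially. a < e (\<sigma> i - j)"
      using le_\<sigma>[of j]
    proof eventually_elim
      case (elim i)
      then show ?case
        using e_upto[of "\<sigma> i - j" j] by simp
    qed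
  next
    fix a assume "d < a"
    then show "\<forall>\<^sub>F i in sequentially. e (\<sigma> i - j) < a"
      using eventually_compose_filterlim[OF upper back_top] by simp
  qed
  define Y where "Y j i = (\<Sum>k<j. lam * e (\<sigma> i - j + k) + \<delta> (\<sigma> i - j + k))" for j i
  have Y_lim: "Y j \<longlonglongrightarrow> real j * (lam * d)" for j
  proof -
    have "(\<lambda>i. e (\<sigma> i - j + k)) \<longlonglongrightarrow> d" if "k < j" for k
    proof (rule Lim_transform_eventually[OF e_back[of "j - k"]])
      \<comment> \<open>Natural subtraction truncates, so the indices are compared only once
        \<open>j \<le> \<sigma> i\<close>.\<close>
      show "\<forall>\<^sub>F i in sequentially. e (\<sigma> i - (j - k)) = e (\<sigma> i - j + k)"
        using le_\<sigma>[of j] by eventually_elim (use that in \<open>simp add: Nat.diff_diff_right\<close>)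
    qed
    then have "Y j \<longlonglongrightarrow> (\<Sum>k<j. lam * d + 0)"
      unfolding Y_def by (intro tendsto_sum tendsto_add tendsto_mult tendsto_const \<delta>_back) auto
    then show ?thesis by simp
  qed
  have y_upto: "norm (y (n + j) - y n) \<le> (\<Sum>k<j. lam * e (n + k) + \<delta> (n + k))" for n j
  proof (induction j)
    case (Suc j)
    have "norm (y (n + Suc j) - y n) \<le> norm (y (Suc (n + j)) - y (n + j)) + norm (y (n + j) - y n)"
      using norm_triangle_ineq[of "y (Suc (n + j)) - y (n + j)" "y (n + j) - y n"] by simp
    then show ?case
      using Suc dy'[of "n + j"] by simp
  qed simp
  text \<open>Looking back \<open>j\<close> steps from a time at which \<open>e\<close> almost attains its upper limit \<open>d\<close>,
    the distances add up as along a straight line.\<close>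
  have far: "\<exists>L. L \<longlonglongrightarrow> (1 + real j * lam) * d \<and>
      (\<forall>\<^sub>F i in sequentially. L i \<le> norm (y (\<sigma> i) - x (\<sigma> i - j)))" for j
  proof (induction j)
    case 0
    show ?case
      by (rule exI[of _ "e \<circ> \<sigma>"]) (use lim in \<open>simp add: e_def comp_def\<close>)
  next
    case (Suc j)
    then obtain L where L: "L \<longlonglongrightarrow> (1 + real j * lam) * d"
      "\<forall>\<^sub>F i in sequentially. L i \<le> norm (y (\<sigma> i) - x (\<sigma> i - j))"
      by blast
    \<comment> \<open>As \<open>x (Suc n)\<close> is a convex combination of \<open>y n\<close> and
      \<open>x n\<close>, the bound at \<open>j\<close> minus the contribution of the path of
      \<open>y\<close>, divided by \<open>1 - lam\<close>, bounds the distance to \<open>x n\<close>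
      from below.\<close>
    define L' where "L' i = (L i - lam * Y (Suc j) i) / (1 - lam)" for i
    have "L' \<longlonglongrightarrow> ((1 + real j * lam) * d - lam * (real (Suc j) * (lam * d))) / (1 - lam)"
      unfolding L'_def by (intro tendsto_intros L Y_lim) (use lam in auto)
    also have "((1 + real j * lam) * d - lam * (real (Suc j) * (lam * d))) / (1 - lam)
        = (1 + real (Suc j) * lam) * d"
      using lam by (simp add: field_simps)
    finally have "L' \<longlonglongrightarrow> (1 + real (Suc j) * lam) * d" .
    moreover have "\<forall>\<^sub>F i in sequentially. L' i \<le> norm (y (\<sigma> i) - x (\<sigma> i - Suc j))"
      using L(2) le_\<sigma>[of "Suc j"]
    proof eventually_elim
      case (elim i)
      define n where "n = \<sigma> i - Suc j"
      have n: "\<sigma> i - j = Suc n" "\<sigma> i = n + Suc j"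
        using elim by (auto simp: n_def)
      have eq: "y (\<sigma> i) - x (Suc n) = lam *\<^sub>R (y (\<sigma> i) - y n) + (1 - lam) *\<^sub>R (y (\<sigma> i) - x n)"
        by (simp add: step algebra_simps)
      have "norm (y (\<sigma> i) - x (Suc n))
          \<le> lam * norm (y (\<sigma> i) - y n) + (1 - lam) * norm (y (\<sigma> i) - x n)"
        using norm_triangle_ineq[of "lam *\<^sub>R (y (\<sigma> i) - y n)" "(1 - lam) *\<^sub>R (y (\<sigma> i) - x n)"] lam
        unfolding eq by simp
      moreover have "norm (y (\<sigma> i) - y n) \<le> Y (Suc j) i"
        using y_upto[of n "Suc j"] unfolding Y_def n(2) by simp
      ultimately have "L i \<le> lam * Y (Suc j) i + (1 - lam) * norm (y (\<sigma> i) - x n)"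
        using elim(1) lam mult_left_mono[of "norm (y (\<sigma> i) - y n)" "Y (Suc j) i" lam]
        unfolding n(1) by linarith
      then show ?case
        using lam by (simp add: L'_def n_def pos_divide_le_eq mult.commute)
    qed
    ultimately show ?case by blast
  qed
  have bound: "(1 + real j * lam) * d \<le> 2 * M" for j
  proof -
    obtain L where L: "L \<longlonglongrightarrow> (1 + real j * lam) * d"
      "\<forall>\<^sub>F i in sequentially. L i \<le> norm (y (\<sigma> i) - x (\<sigma> i - j))"
      using far by blast
    have "\<forall>\<^sub>F i in sequentially. L i \<le> 2 * M"
      using L(2)
    proof eventually_elim
      case (elim i)
      then show ?case
        using norm_triangle_ineq4[of "y (\<sigma> i)" "x (\<sigma> i - j)"] y[of "\<sigma> i"] x[of "\<sigma> i - j"] by linarith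
    qed
    then show ?thesis
      by (intro tendsto_upperbound[OF L(1)]) auto
  qed
  have "d = 0"
  proof (rule ccontr)
    assume "d \<noteq> 0"
    then have "lam * d > 0"
      using \<open>d \<ge> 0\<close> lam by simp
    then obtain j where "2 * M < real j * (lam * d)"
      using reals_Archimedean3 by blast
    then show False
      using bound[of j] \<open>d \<ge> 0\<close> by (simp add: algebra_simps)
  qed
  have "e \<longlonglongrightarrow> 0"
  proof (rule order_tendstoI)
    fix a :: real assume "a < 0"
    then show "\<forall>\<^sub>F n in sequentially. a < e n"
      by (intro always_eventually allI) (rule less_le_trans[OF _ e_bounds(1)])
  qed (use upper \<open>d = 0\<close> in auto)
  then show ?thesis
    unfolding e_def by (simp add: tendsto_norm_zero_iff)
qed

section \<open>One-parameter semigroups\<close>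

text \<open>If \<open>s + b\<close> and \<open>b\<close> fix \<open>z\<close>, so does
  \<open>s\<close>; hence non-negative differences of lattice times fix \<open>z\<close> too. By
  irrationality these are dense in the half-line. The fixing times form a closed set, since points
  are closed in \<tau> and the orbit map is continuous.\<close>

lemma common_fixed_point_if_lattice_fixed:
  fixes T :: "real \<Rightarrow> 'a::real_normed_vector \<Rightarrow> 'a"
  assumes \<tau>: "topspace \<tau> = UNIV" "Hausdorff_space \<tau>"
    and T: "nonexpansive_semigroup_on \<tau> C T"
    and pos: "\<alpha> > 0" "\<beta> > 0" and irr: "\<alpha> / \<beta> \<notin> \<rat>"
    and z: "z \<in> C"
    and fixed: "\<And>k l. T (real k * \<alpha> + real l * \<beta>) z = z"
  shows "common_fixed_point_on C T z"
proof -
  have add: "T (s + t) x = T s (T t x)" if "0 \<le> s" "0 \<le> t" "x \<in> C" for s t x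
    using T that unfolding nonexpansive_semigroup_on_def by blast
  have cont: "continuous_map (top_of_set {0..}) (subtopology \<tau> C) (\<lambda>t. T t z)"
    using T z unfolding nonexpansive_semigroup_on_def by blast
  define S where "S = {t \<in> {0..}. T t z = z}"
  have fixed_int: "T (real_of_int k * \<alpha> + real_of_int l * \<beta>) z = z"
    if "0 \<le> k" "0 \<le> real_of_int k * \<alpha> + real_of_int l * \<beta>" for k l :: int
  proof (cases "0 \<le> l")
    case True
    then show ?thesis
      using fixed[of "nat k" "nat l"] \<open>0 \<le> k\<close> by simp
  next
    case False
    define s b where "s = real_of_int k * \<alpha> + real_of_int l * \<beta>" and "b = real (nat (- l)) * \<beta>"
    have "s + b = real (nat k) * \<alpha> + real 0 * \<beta>"
      using False \<open>0 \<le> k\<close> by (simp add: s_def b_def algebra_simps)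
    then have "T (s + b) z = z"
      using fixed by metis
    moreover have "T b z = z"
      using fixed[of 0 "nat (- l)"] by (simp add: b_def)
    moreover have "0 \<le> b"
      using pos by (simp add: b_def)
    ultimately show ?thesis
      using add[of s b z] that z by (simp add: s_def)
  qed
  have "closedin (subtopology \<tau> C) {z}"
    using \<tau> z by (intro closedin_subset_topspace closedin_Hausdorff_sing_eq[THEN iffD2]) auto
  then have "closedin (top_of_set {0..}) {t \<in> topspace (top_of_set {0..}). T t z \<in> {z}}"
    using closedin_continuous_map_preimage[OF cont] by blast
  then have "closed S"
    unfolding S_def by (auto intro: closedin_closed_trans)
  moreover have "t \<in> closure S" if "0 \<le> t" for t
    unfolding closure_approachable
  proof (intro allI impI)
    fix \<epsilon> :: real assume "0 < \<epsilon>"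
    then have "0 < \<epsilon> / (2 * \<beta>)"
      using pos by simp
    \<comment> \<open>Aiming at \<open>t + \<epsilon> / 2\<close> with tolerance
      \<open>\<epsilon> / 2\<close> puts the approximating time strictly between \<open>t\<close>
      and \<open>t + \<epsilon>\<close>, so it is non-negative.\<close>
    then obtain h k where k: "0 < k" and
      approx: "\<bar>of_int k * (\<alpha> / \<beta>) - of_int h - (t + \<epsilon> / 2) / \<beta>\<bar> < \<epsilon> / (2 * \<beta>)"
      using sequence_of_fractional_parts_is_dense[OF irr] by metis
    define s where "s = real_of_int k * \<alpha> + real_of_int (- h) * \<beta>"
    have "s - (t + \<epsilon> / 2) = \<beta> * (of_int k * (\<alpha> / \<beta>) - of_int h - (t + \<epsilon> / 2) / \<beta>)"
      using pos by (simp add: s_def field_simps)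
    then have "\<bar>s - (t + \<epsilon> / 2)\<bar> = \<beta> * \<bar>of_int k * (\<alpha> / \<beta>) - of_int h - (t + \<epsilon> / 2) / \<beta>\<bar>"
      using pos by (simp add: abs_mult)
    also have "\<dots> < \<beta> * (\<epsilon> / (2 * \<beta>))"
      using approx pos by (intro mult_strict_left_mono)
    also have "\<dots> = \<epsilon> / 2"
      using pos by simp
    finally have "t < s" "s < t + \<epsilon>"
      by linarith+
    moreover have "s \<in> S"
      using fixed_int[of k "- h"] k \<open>t < s\<close> \<open>0 \<le> t\<close> unfolding S_def s_def by simp
    ultimately show "\<exists>s\<in>S. dist s t < \<epsilon>"
      by (auto simp: dist_real_def intro!: bexI[of _ s])
  qed
  ultimately have "{0..} \<subseteq> S"
    by (auto simp: closure_closed)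
  then show ?thesis
    using z unfolding common_fixed_point_on_def S_def by auto
qed

section \<open>The squares as a Folner sequence\<close>

definition square :: "nat \<Rightarrow> (nat \<times> nat) set" where
  "square n = {1..Suc n} \<times> {1..Suc n}"

lemma finite_square [simp]: "finite (square n)"
  and square_nonempty [simp]: "square n \<noteq> {}"
  and card_square: "card (square n) = (Suc n)\<^sup>2"
  by (auto simp: square_def power2_eq_square)

text \<open>A point of the square missed by the translate by \<open>(a, b)\<close> has first
  coordinate at most \<open>a\<close> or second at most \<open>b\<close>; these strips hold at most
  \<open>(a + b) * Suc n\<close> of the \<open>(Suc n)\<^sup>2\<close> points.\<close>

lemma square_folner:
  "(\<lambda>n. real (card (square n - (+) g ` square n)) / real (card (square n))) \<longlonglongrightarrow> 0"
proof -
  obtain a b where g: "g = (a, b)"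
    by fastforce
  define q where "q n = card (square n - (+) g ` square n)" for n
  have q: "q n \<le> (a + b) * Suc n" for n
  proof -
    have "square n - (+) g ` square n \<subseteq> {1..a} \<times> {1..Suc n} \<union> {1..Suc n} \<times> {1..b}"
    proof
      fix m assume m: "m \<in> square n - (+) g ` square n"
      obtain i j where ij: "m = (i, j)"
        by fastforce
      have "m \<in> (+) g ` square n" if "a < i" "b < j"
        using m that by (intro image_eqI[of _ _ "(i - a, j - b)"]) (auto simp: g ij square_def)
      then show "m \<in> {1..a} \<times> {1..Suc n} \<union> {1..Suc n} \<times> {1..b}"
        using m by (auto simp: ij square_def not_less)
    qed
    then have "q n \<le> card ({1..a} \<times> {1..Suc n} \<union> {1..Suc n} \<times> {1..b})"
      unfolding q_def by (intro card_mono) auto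
    also have "\<dots> \<le> (a + b) * Suc n"
      using card_Un_le[of "{1..a} \<times> {1..Suc n}" "{1..Suc n} \<times> {1..b}"] by (simp add: algebra_simps)
    finally show ?thesis .
  qed
  have "norm (real (q n) / real (card (square n))) \<le> real (a + b) * (1 / real (Suc n))" for n
  proof -
    have "real (q n) \<le> real (a + b) * real (Suc n)"
      using q[of n] by (metis of_nat_le_iff of_nat_mult)
    then have "real (q n) / real (card (square n)) \<le> real (a + b) * real (Suc n) / (real (Suc n))\<^sup>2"
      unfolding card_square of_nat_power by (rule divide_right_mono) simp
    then show ?thesis
      by (simp add: power2_eq_square)
  qed
  then have "\<forall>\<^sub>F n in sequentially.
      norm (real (q n) / real (card (square n))) \<le> real (a + b) * (1 / real (Suc n))"
    by (intro always_eventually allI)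
  moreover have "(\<lambda>n. real (a + b) * (1 / real (Suc n))) \<longlonglongrightarrow> 0"
    by (intro tendsto_mult_right_zero LIMSEQ_Suc[OF lim_1_over_n])
  ultimately show ?thesis
    unfolding q_def by (rule Lim_null_comparison)
qed

text \<open>Consecutive squares differ by \<open>2 * n + 3\<close> points out of
  \<open>(n + 2)\<^sup>2\<close>. The resulting drift is the perturbation \<delta> of
  \<open>averaged_iteration_asymptotic\<close>.\<close>

lemma mean_square_diff_le:
  fixes f :: "nat \<times> nat \<Rightarrow> 'a::real_normed_vector"
  assumes "\<And>i. norm (f i) \<le> M"
  shows "norm (mean (square (Suc n)) f - mean (square n) f) \<le> 4 * M * (1 / real (n + 2))"
proof -
  have "0 \<le> M"
    using assms norm_ge_zero order_trans by blast
  have "norm (mean (square (Suc n)) f - mean (square n) f)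
      \<le> 2 * M * (real (card (square (Suc n))) - real (card (square n))) / real (card (square (Suc n)))"
    by (rule norm_mean_superset_diff_le) (use assms in \<open>auto simp: square_def\<close>)
  also have "\<dots> = 2 * M * (2 * real n + 3) / (real (n + 2))\<^sup>2"
    unfolding card_square by (simp add: power2_eq_square algebra_simps)
  also have "\<dots> \<le> 2 * M * (2 * real (n + 2)) / (real (n + 2))\<^sup>2"
    using \<open>0 \<le> M\<close> by (intro divide_right_mono mult_left_mono) auto
  also have "\<dots> = 4 * M * (1 / real (n + 2))"
  proof -
    have "2 * M * (2 * w) / w\<^sup>2 = 4 * M * (1 / w)" for w
      by (cases "w = 0") (simp_all add: power2_eq_square)
    then show ?thesis .
  qed
  finally show ?thesis .
qed

text \<open>Fejer monotonicity: once one term of the subsequence is within \<epsilon> of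
  \<open>z\<close>, all later terms of \<open>x\<close> stay there.\<close>

lemma tendsto_if_norm_diff_antimono:
  fixes x :: "nat \<Rightarrow> 'a::real_normed_vector"
  assumes "\<And>n. norm (x (Suc n) - z) \<le> norm (x n - z)"
    and "strict_mono \<sigma>" "(x \<circ> \<sigma>) \<longlonglongrightarrow> z"
  shows "x \<longlonglongrightarrow> z"
proof (rule LIMSEQ_I)
  fix \<epsilon> :: real assume "0 < \<epsilon>"
  then obtain i where "norm (x (\<sigma> i) - z) < \<epsilon>"
    using LIMSEQ_D[OF assms(3)] by fastforce
  moreover have "norm (x n - z) \<le> norm (x (\<sigma> i) - z)" if "\<sigma> i \<le> n" for n
    using lift_Suc_antimono_le[of "\<lambda>n. norm (x n - z)"] assms(1) that by blast
  ultimately show "\<exists>N. \<forall>n\<ge>N. norm (x n - z) < \<epsilon>"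
    by (intro exI[of _ "\<sigma> i"]) (auto intro: le_less_trans)
qed

theorem theorem8:
  fixes \<tau> :: "'a::banach topology"
    and C :: "'a set"
    and T :: "real \<Rightarrow> 'a \<Rightarrow> 'a"
    and \<alpha> \<beta> lam :: real
    and x :: "nat \<Rightarrow> 'a"
  assumes "topspace \<tau> = UNIV" and "Hausdorff_space \<tau>"
    and "compact C" and "convex C"
    and "nonexpansive_semigroup_on \<tau> C T"
    and "\<alpha> > 0" and "\<beta> > 0" and "\<alpha> / \<beta> \<notin> \<rat>"
    and "0 < lam" and "lam < 1"
    and "x 1 \<in> C"
    and "\<And>n. n \<ge> 1 \<Longrightarrow>
      x (n + 1) = (lam / (real n)\<^sup>2) *\<^sub>R (\<Sum>k=1..n. \<Sum>l=1..n. T (real k * \<alpha> + real l * \<beta>) (x n))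
                  + (1 - lam) *\<^sub>R x n"
  shows "\<exists>z. common_fixed_point_on C T z \<and> x \<longlonglongrightarrow> z"
proof -

  \<comment> \<open>Reduction to the lattice action\<close>
  note C = \<open>compact C\<close> and T = \<open>nonexpansive_semigroup_on \<tau> C T\<close> and pos = \<open>\<alpha> > 0\<close> \<open>\<beta> > 0\<close>
    and lam = \<open>0 < lam\<close> \<open>lam < 1\<close>
  define U where "U = (\<lambda>(k, l). T (real k * \<alpha> + real l * \<beta>))"
  have U_pair: "U (k, l) = T (real k * \<alpha> + real l * \<beta>)" for k l
    by (simp add: U_def)
  have nonneg: "0 \<le> real k * \<alpha> + real l * \<beta>" for k l
    using pos by simp
  interpret nonexpansive_action C U
  proof
    fix g h :: "nat \<times> nat" and u v :: 'a
    assume u: "u \<in> C"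
    obtain k l k' l' where gh: "g = (k, l)" "h = (k', l')"
      by fastforce
    show "U g u \<in> C"
      using T u nonneg unfolding gh U_pair nonexpansive_semigroup_on_def by blast
    have "T ((real k * \<alpha> + real l * \<beta>) + (real k' * \<alpha> + real l' * \<beta>)) u
        = T (real k * \<alpha> + real l * \<beta>) (T (real k' * \<alpha> + real l' * \<beta>) u)"
      using T u nonneg unfolding nonexpansive_semigroup_on_def by blast
    then show "U (g + h) u = U g (U h u)"
      by (simp add: gh U_pair algebra_simps)
    show "norm (U g u - U g v) \<le> norm (u - v)" if "v \<in> C"
      using T u that nonneg unfolding gh U_pair nonexpansive_semigroup_on_def by blast
  qed
  define A where "A n u = mean (square n) (\<lambda>g. U g u)" for n u
  \<comment> \<open>The shift gives \<open>X 0 = x 1\<close> and matches the side length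
    \<open>Suc n\<close> of \<open>square n\<close>: the mean \<open>A n\<close> is the one that
    defines \<open>x (n + 2)\<close>.\<close>
  define X where "X n = x (Suc n)" for n
  have step: "X (Suc n) = lam *\<^sub>R A n (X n) + (1 - lam) *\<^sub>R X n" for n
  proof -
    have "(lam / (real (Suc n))\<^sup>2) *\<^sub>R
        (\<Sum>k=1..Suc n. \<Sum>l=1..Suc n. T (real k * \<alpha> + real l * \<beta>) (X n)) = lam *\<^sub>R A n (X n)"
      unfolding A_def mean_def card_square
      by (simp only: square_def sum.cartesian_product U_def divide_inverse scaleR_scaleR of_nat_power
        case_prod_unfold)
    then show ?thesis
      using assms(12)[of "Suc n"] by (simp add: X_def)
  qed
  have A_closed: "A n u \<in> C" if "u \<in> C" for n u
    unfolding A_def using \<open>convex C\<close> closed[OF that] by (intro mean_in_convex) auto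
  have A_nonexpansive: "norm (A n u - A n v) \<le> norm (u - v)" if "u \<in> C" "v \<in> C" for n u v
    unfolding A_def using nonexpansive[OF that] by (intro norm_mean_diff_le) auto
  have X [simp]: "X n \<in> C" for n
  proof (induction n)
    case 0
    show ?case using \<open>x 1 \<in> C\<close> by (simp add: X_def)
  next
    case (Suc n)
    then show ?case
      unfolding step using lam by (intro convexD \<open>convex C\<close> A_closed) auto
  qed
  obtain M where M: "\<And>u. u \<in> C \<Longrightarrow> norm u \<le> M"
    using compact_imp_bounded[OF C] bounded_iff by metis
  have approx_fixed: "(\<lambda>n. A n (X n) - X n) \<longlonglongrightarrow> 0"
  proof (rule averaged_iteration_asymptotic[of X M "\<lambda>n. A n (X n)" lam "\<lambda>n. 4 * M * (1 / real (n + 2))", OF _ _ lam step])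
    show "norm (X n) \<le> M" "norm (A n (X n)) \<le> M" for n
      using M A_closed by auto
    show "(\<lambda>n. 4 * M * (1 / real (n + 2))) \<longlonglongrightarrow> 0"
      by (intro tendsto_mult_right_zero LIMSEQ_ignore_initial_segment[OF lim_1_over_n])
    show "norm (A (Suc n) (X (Suc n)) - A n (X n)) \<le> norm (X (Suc n) - X n) + 4 * M * (1 / real (n + 2))" for n
    proof -
      have "norm (A (Suc n) (X n) - A n (X n)) \<le> 4 * M * (1 / real (n + 2))"
        unfolding A_def by (intro mean_square_diff_le M closed X)
      then show ?thesis
        using norm_triangle_ineq[of "A (Suc n) (X (Suc n)) - A (Suc n) (X n)" "A (Suc n) (X n) - A n (X n)"]
          A_nonexpansive[OF X X, of "Suc n" "Suc n" n] by simp
    qed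
  qed

  \<comment> \<open>Cluster point and convergence\<close>
  obtain z \<sigma> where z: "z \<in> C" and \<sigma>: "strict_mono \<sigma>" and lim: "(X \<circ> \<sigma>) \<longlonglongrightarrow> z"
    using compact_imp_seq_compact[OF C] X by (metis seq_compactE)
  \<comment> \<open>Replacing \<open>X (\<sigma> i)\<close> by \<open>z\<close> costs their distance
    twice: once inside the nonexpansive mean, once outside.\<close>
  have "(\<lambda>i. A (\<sigma> i) z - z) \<longlonglongrightarrow> 0"
  proof (rule Lim_null_comparison)
    have "(\<lambda>i. A (\<sigma> i) (X (\<sigma> i)) - X (\<sigma> i)) \<longlonglongrightarrow> 0"
      using LIMSEQ_subseq_LIMSEQ[OF approx_fixed \<sigma>] by (simp add: comp_def)
    moreover have "(\<lambda>i. X (\<sigma> i) - z) \<longlonglongrightarrow> 0"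
      using lim by (simp add: comp_def LIM_zero)
    ultimately show "(\<lambda>i. 2 * norm (X (\<sigma> i) - z) + norm (A (\<sigma> i) (X (\<sigma> i)) - X (\<sigma> i))) \<longlonglongrightarrow> 0"
      by (auto intro!: tendsto_add_zero tendsto_mult_right_zero tendsto_norm_zero)
    have "norm (A (\<sigma> i) z - z) \<le> 2 * norm (X (\<sigma> i) - z) + norm (A (\<sigma> i) (X (\<sigma> i)) - X (\<sigma> i))" for i
    proof -
      have "A (\<sigma> i) z - z = (A (\<sigma> i) z - A (\<sigma> i) (X (\<sigma> i)))
          + ((A (\<sigma> i) (X (\<sigma> i)) - X (\<sigma> i)) + (X (\<sigma> i) - z))"
        by simp
      then have "norm (A (\<sigma> i) z - z) \<le> norm (A (\<sigma> i) z - A (\<sigma> i) (X (\<sigma> i)))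
          + (norm (A (\<sigma> i) (X (\<sigma> i)) - X (\<sigma> i)) + norm (X (\<sigma> i) - z))"
        by (simp only:) (intro norm_triangle_mono order_refl)
      then show ?thesis
        using A_nonexpansive[OF z X, of "\<sigma> i" "\<sigma> i"] by (simp add: norm_minus_commute)
    qed
    then show "\<forall>\<^sub>F i in sequentially. norm (A (\<sigma> i) z - z)
        \<le> 2 * norm (X (\<sigma> i) - z) + norm (A (\<sigma> i) (X (\<sigma> i)) - X (\<sigma> i))"
      by simp
  qed
  then have mean_lim: "(\<lambda>i. mean (square (\<sigma> i)) (\<lambda>g. U g z)) \<longlonglongrightarrow> z"
    by (simp add: A_def LIM_zero_iff)
  \<comment> \<open>The means are known to converge only along \<sigma>, so the subsequence of
    squares serves as the Folner sequence.\<close>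
  have fixed: "U g z = z" for g
  proof (rule fixed_point_if_mean_tendsto[OF C z _ _ _ mean_lim])
    show "(\<lambda>i. real (card (square (\<sigma> i) - (+) g ` square (\<sigma> i))) / real (card (square (\<sigma> i)))) \<longlonglongrightarrow> 0" for g
      using LIMSEQ_subseq_LIMSEQ[OF square_folner \<sigma>] by (simp add: comp_def)
  qed auto
  have "common_fixed_point_on C T z"
    by (rule common_fixed_point_if_lattice_fixed[OF assms(1,2) T pos assms(8) z])
      (use fixed U_pair in metis)
  \<comment> \<open>Every mean \<open>A n\<close> fixes \<open>z\<close>, so the next iterate is a
    convex combination of two points no farther from \<open>z\<close> than
    \<open>X n\<close>.\<close>
  moreover have "norm (X (Suc n) - z) \<le> norm (X n - z)" for n
  proof -
    have "A n z = z"
      using fixed by (simp add: A_def mean_const)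
    have "X (Suc n) - z = lam *\<^sub>R (A n (X n) - z) + (1 - lam) *\<^sub>R (X n - z)"
      by (simp add: step algebra_simps)
    also have "norm \<dots> \<le> lam * norm (A n (X n) - z) + (1 - lam) * norm (X n - z)"
      using norm_triangle_ineq[of "lam *\<^sub>R (A n (X n) - z)" "(1 - lam) *\<^sub>R (X n - z)"] lam by simp
    also have "\<dots> \<le> lam * norm (X n - z) + (1 - lam) * norm (X n - z)"
      using A_nonexpansive[OF X z, of n n] lam \<open>A n z = z\<close> by (intro add_mono mult_left_mono) auto
    finally show ?thesis
      by (simp add: algebra_simps)
  qed
  then have "X \<longlonglongrightarrow> z"
    using tendsto_if_norm_diff_antimono \<sigma> lim by blast
  then have "x \<longlonglongrightarrow> z"
    unfolding X_def by (rule LIMSEQ_imp_Suc)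
  ultimately show ?thesis
    by blast
qed

end
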